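(* For every $k\in\mathbb{Z}^+$ it holds that $$T_*(k,k) = T(k,k).$$ If $b=\lceil xN \rceil$ and $w=\lfloor (1-x)N \rfloor$ for a fixed $\frac{1}{2}<x<1$ and $N\in\mathbb{Z}^+$, then as $N\to\infty$, $$T_*(w,b) - T(w,b) \to 0.$$
   Context: Mabinogion urn model (M-process): an urn contains white and black balls. At each time $1,2,3,\dots$ one ball is drawn uniformly at random from the urn, independently of previous selections, its color is observed and it is returned. If the drawn ball is white, one black ball is replaced by a white one; if the drawn ball is black, one white ball is replaced by a black one. The process stops when all balls are of the same color. Let $W_n,B_n$ be the numbers of white and black balls after $n$ transitions; thus $(W_n,B_n)$ is a Markov chain which, from a state $(w,b)$ with $w,b>0$, moves to $(w+1,b-1)$ with probability $\frac{w}{w+b}$ and to $(w-1,b+1)$ with probability $\frac{b}{w+b}$; states with $w=0$ or $b=0$ are absorbing. Let $H:=\min\{n: W_n=0 \text{ or } B_n=0\}$. Then $T(w,b):=\mathbf{E}(H\mid W_0=w,B_0=b)$ is the expected time to absorption, and $$T_*(w,b) := \mathbf{E}(H \mid W_0=w,\ B_0=b,\ W_H=0)$$ is the expected time to absorption conditioned on the event that only black balls are left at absorption. *)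

theory Defs
  imports "HOL-Probability.Probability"
begin

text \<open>
  A state is a pair \<open>(w, b)\<close> of the numbers of white and black balls. The total \<open>w + b\<close> is
  constant, so the balls can be labelled \<open>0, ..., w + b - 1\<close>, with the current white balls being
  those with label \<open>< w\<close>; a draw is then a label.
\<close>

definition urn_step :: "nat \<times> nat \<Rightarrow> nat \<Rightarrow> nat \<times> nat" where
  "urn_step s d = (case s of (w, b) \<Rightarrow>
     if w = 0 \<or> b = 0 then (w, b)
     else if d < w then (w + 1, b - 1)
     else (w - 1, b + 1))"

primrec urn :: "nat \<times> nat \<Rightarrow> nat \<Rightarrow> nat stream \<Rightarrow> nat \<times> nat" where
  "urn s 0 \<omega> = s"
| "urn s (Suc n) \<omega> = urn_step (urn s n \<omega>) (\<omega> !! n)"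

definition draws :: "nat \<times> nat \<Rightarrow> nat stream measure" where
  "draws s = stream_space (measure_pmf (pmf_of_set {..<fst s + snd s}))"

text \<open>The absorption time is \<open>\<infinity>\<close> on draw sequences that never reach a monochromatic state.\<close>

definition absorption_time :: "nat \<times> nat \<Rightarrow> nat stream \<Rightarrow> enat" where
  "absorption_time s \<omega> = (INF n \<in> {n. fst (urn s n \<omega>) = 0 \<or> snd (urn s n \<omega>) = 0}. enat n)"

definition absorbed_black :: "nat \<times> nat \<Rightarrow> nat stream set" where
  "absorbed_black s = {\<omega> \<in> space (draws s). absorption_time s \<omega> \<noteq> \<infinity> \<and>
     fst (urn s (the_enat (absorption_time s \<omega>)) \<omega>) = 0}"

text \<open>
  Expectations are taken in \<open>[0, \<infinity>]\<close>, so no integrability assumption is needed. They are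
  embedded in \<^typ>\<open>ereal\<close>, because subtraction on \<^typ>\<open>ennreal\<close> is truncated; on \<^typ>\<open>ereal\<close>
  a difference involving \<open>\<infinity>\<close> is never finite (in particular \<open>\<infinity> - \<infinity> = \<infinity>\<close>).
\<close>

definition T :: "nat \<Rightarrow> nat \<Rightarrow> ereal" where
  "T w b = enn2ereal (\<integral>\<^sup>+ \<omega>. ennreal_of_enat (absorption_time (w, b) \<omega>) \<partial>draws (w, b))"

definition T_star :: "nat \<Rightarrow> nat \<Rightarrow> ereal" where
  "T_star w b = enn2ereal (\<integral>\<^sup>+ \<omega>. ennreal_of_enat (absorption_time (w, b) \<omega>)
     \<partial>uniform_measure (draws (w, b)) (absorbed_black (w, b)))"

lemma urn_step_law:
  fixes w b :: nat
  assumes "w > 0" "b > 0"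
  shows "pmf (map_pmf (urn_step (w, b)) (pmf_of_set {..<w + b})) (w + 1, b - 1) = real w / real (w + b)"
    and "pmf (map_pmf (urn_step (w, b)) (pmf_of_set {..<w + b})) (w - 1, b + 1) = real b / real (w + b)"
proof -
  have ne: "{..<w + b} \<noteq> {}" using assms by auto
  have "urn_step (w, b) -` {(w + 1, b - 1)} = {..<w}"
    using assms by (auto simp: urn_step_def split: if_splits)
  moreover have "{..<w + b} \<inter> {..<w} = {..<w}" by auto
  ultimately show "pmf (map_pmf (urn_step (w, b)) (pmf_of_set {..<w + b})) (w + 1, b - 1) = real w / real (w + b)"
    using ne by (simp add: pmf_map measure_pmf_of_set[OF ne finite_lessThan])
  have "urn_step (w, b) -` {(w - 1, b + 1)} = {w..}"
    using assms by (auto simp: urn_step_def split: if_splits)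
  moreover have "{..<w + b} \<inter> {w..} = {w..<w + b}" by auto
  ultimately show "pmf (map_pmf (urn_step (w, b)) (pmf_of_set {..<w + b})) (w - 1, b + 1) = real b / real (w + b)"
    using ne by (simp add: pmf_map measure_pmf_of_set[OF ne finite_lessThan])
qed

end

theory Submission
  imports Defs
begin

text \<open>
  Put \<open>m = w + b\<close>. The probability that white wins is \<open>g w = P(Bin(m - 1, 1/2) < w)\<close>, which is
  harmonic for the chain. Let \<open>x\<close> and \<open>y\<close> be the expectations of the absorption time on the events
  that white, respectively black, wins, so that \<open>T = x + y\<close> and \<open>T\<^sub>* = y / (1 - p)\<close>, where \<open>p\<close> is the
  probability that white wins. For \<open>w = b\<close>, exchanging the colours gives \<open>x = y\<close> and \<open>p = 1/2\<close>.
  In general, \<open>x\<close> is dominated by every nonnegative \<open>V\<close> with \<open>V \<ge> g + P V\<close> inside, \<open>P\<close> being the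
  transition operator, and an explicit such \<open>V\<close> satisfies \<open>V \<le> m\<^sup>3 g\<close>. Hence \<open>x \<le> m\<^sup>3 g w\<close>,
  \<open>y \<le> m\<^sup>3\<close> and \<open>\<bar>T\<^sub>* - T\<bar> = O(m\<^sup>3 g w)\<close>, which tends to \<open>0\<close> by a Chernoff bound when \<open>w/m\<close>
  stays below a constant smaller than \<open>1/2\<close>.
\<close>

subsection \<open>Binomial tails and the potential\<close>

text \<open>The ends \<open>0\<close> and \<open>m\<close> are absorbing, so a harmonic function has
  \<open>m\<close> increments, indexed \<open>0, ..., m - 1\<close>. This is why row
  \<open>m - 1\<close> of Pascal's triangle occurs; the factor \<open>2 ^ (m - 1)\<close> makes the
  increments sum to 1.\<close>

definition binom_weight :: "nat \<Rightarrow> nat \<Rightarrow> real" where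
  "binom_weight m j = real ((m - 1) choose j) / 2 ^ (m - 1)"

definition binom_cdf :: "nat \<Rightarrow> nat \<Rightarrow> real" where
  "binom_cdf m w = (\<Sum>j<w. binom_weight m j)"

lemma binom_weight_nonneg: "0 \<le> binom_weight m j"
  by (simp add: binom_weight_def)

lemma binom_weight_pos: "j < m \<Longrightarrow> 0 < binom_weight m j"
  by (simp add: binom_weight_def)

text \<open>Consecutive weights stand in the ratio of the down and up probabilities at
  \<open>Suc w\<close>, which is the condition on increments for their partial sums to be
  harmonic.\<close>

lemma binom_weight_step:
  assumes "Suc w \<le> m"
  shows "real (Suc w) * binom_weight m (Suc w) = real (m - Suc w) * binom_weight m w"
proof -
  have "Suc w * ((m - 1) choose Suc w) = (m - Suc w) * ((m - 1) choose w)"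
    using binomial_absorption[of w "m - 1"] binomial_absorb_comp[of "m - 1" w] by simp
  then have "real (Suc w) * real ((m - 1) choose Suc w) = real (m - Suc w) * real ((m - 1) choose w)"
    by (metis of_nat_mult)
  then show ?thesis by (simp add: binom_weight_def)
qed

lemma binom_weight_symmetric: "j < m \<Longrightarrow> binom_weight m (m - 1 - j) = binom_weight m j"
  unfolding binom_weight_def using binomial_symmetric[of j "m - 1"] by simp

lemma binom_cdf_Suc: "binom_cdf m (Suc w) = binom_cdf m w + binom_weight m w"
  by (simp add: binom_cdf_def)

lemma binom_cdf_0 [simp]: "binom_cdf m 0 = 0"
  by (simp add: binom_cdf_def)

lemma binom_cdf_mono: "v \<le> w \<Longrightarrow> binom_cdf m v \<le> binom_cdf m w"
  unfolding binom_cdf_def by (rule sum_mono2) (auto simp: binom_weight_nonneg)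

lemma binom_cdf_nonneg: "0 \<le> binom_cdf m w"
  by (simp add: binom_cdf_def binom_weight_nonneg sum_nonneg)

lemma binom_cdf_full:
  assumes "0 < m" shows "binom_cdf m m = 1"
proof -
  have "{..<m} = {..m - 1}" using assms by auto
  then have "(\<Sum>j<m. real ((m - 1) choose j)) = 2 ^ (m - 1)"
    by (metis choose_row_sum of_nat_numeral of_nat_power of_nat_sum)
  then show ?thesis
    by (simp add: binom_cdf_def binom_weight_def flip: sum_divide_distrib)
qed

lemma binom_cdf_le_1: "0 < m \<Longrightarrow> w \<le> m \<Longrightarrow> binom_cdf m w \<le> 1"
  using binom_cdf_mono[of w m m] binom_cdf_full by simp

lemma binom_cdf_compl:
  assumes "0 < m" "w \<le> m" shows "1 - binom_cdf m w = (\<Sum>j=w..<m. binom_weight m j)"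
proof -
  have "binom_cdf m m = binom_cdf m w + (\<Sum>j=w..<m. binom_weight m j)"
    unfolding binom_cdf_def lessThan_atLeast0 using assms by (intro sum.atLeastLessThan_concat[symmetric]) auto
  then show ?thesis using binom_cdf_full[OF assms(1)] by simp
qed

lemma binom_cdf_symmetric:
  assumes "0 < m" "w \<le> m" shows "binom_cdf m (m - w) = 1 - binom_cdf m w"
proof -
  have "binom_cdf m (m - w) = (\<Sum>j=w..<m. binom_weight m (m - 1 - j))"
    unfolding binom_cdf_def
    by (rule sum.reindex_bij_witness[of _ "\<lambda>j. m - 1 - j" "\<lambda>j. m - 1 - j"]) (use assms in auto)
  also have "\<dots> = 1 - binom_cdf m w"
    unfolding binom_cdf_compl[OF assms] by (intro sum.cong refl binom_weight_symmetric) simp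
  finally show ?thesis .
qed

text \<open>The mean change over one step is \<open>(w * c w - (m - w) * c (w - 1)) / m\<close> with
  \<open>c = binom_weight m\<close>, and this vanishes by \<open>binom_weight_step\<close>.\<close>

lemma binom_cdf_harmonic:
  assumes "0 < w" "w < m"
  shows "real w / real m * binom_cdf m (Suc w) + real (m - w) / real m * binom_cdf m (w - 1) = binom_cdf m w"
proof -
  obtain v where v: "w = Suc v" using assms by (cases w) auto
  then have v1: "w - 1 = v" by simp
  have s: "real w * binom_weight m w = real (m - w) * binom_weight m v"
    using binom_weight_step[of v m] assms v by simp
  have "real w * binom_cdf m (Suc w) + real (m - w) * binom_cdf m v =
     (real w + real (m - w)) * binom_cdf m w + (real w * binom_weight m w - real (m - w) * binom_weight m v)"
    by (simp add: v binom_cdf_Suc algebra_simps)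
  also have "\<dots> = real m * binom_cdf m w" using s assms by (simp flip: of_nat_add)
  finally have "(real w * binom_cdf m (Suc w) + real (m - w) * binom_cdf m v) / real m = binom_cdf m w"
    using assms by simp
  then show ?thesis by (simp only: v1 add_divide_distrib times_divide_eq_left)
qed

text \<open>
  The solution of \<open>V = g + P V\<close> for \<open>g = binom_cdf m\<close> with \<open>V 0 = 0\<close> and increment
  \<open>m ^ 3 * binom_weight m 0\<close> at \<open>0\<close>; this increment is large enough to make \<open>V\<close> nonnegative.
  It is found by writing \<open>V (w + 1) - V w\<close> as a multiple of \<open>binom_weight m w\<close>.
\<close>

definition tail_ratio :: "nat \<Rightarrow> nat \<Rightarrow> real" where
  "tail_ratio m i = real m * binom_cdf m i / (real i * binom_weight m i)"

definition potential :: "nat \<Rightarrow> nat \<Rightarrow> real" where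
  "potential m w = real m ^ 3 * binom_cdf m w
     - (\<Sum>i=1..<w. tail_ratio m i * (binom_cdf m w - binom_cdf m i))"

lemma tail_ratio_nonneg: "0 \<le> tail_ratio m i"
  by (simp add: tail_ratio_def binom_cdf_nonneg binom_weight_nonneg)

text \<open>By unimodality of the binomial coefficients, the tail on the side of \<open>i\<close>
  away from the centre consists of at most \<open>m\<close> weights, none above the weight at
  \<open>i\<close>. The other factor is at most 1.\<close>

lemma cdf_product_le:
  assumes "i < m"
  shows "binom_cdf m i * (1 - binom_cdf m i) \<le> real m * binom_weight m i"
proof -
  have g: "0 \<le> binom_cdf m i" "binom_cdf m i \<le> 1" using assms
    by (auto simp: binom_cdf_nonneg intro: binom_cdf_le_1)
  show ?thesis
  proof (cases "2 * i \<le> m - 1")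
    case True
    have "binom_cdf m i \<le> (\<Sum>j<i. binom_weight m i)"
      unfolding binom_cdf_def binom_weight_def
      by (intro sum_mono divide_right_mono) (use True in \<open>auto intro!: binomial_mono\<close>)
    also have "\<dots> \<le> real m * binom_weight m i"
      using assms by (simp add: mult_right_mono binom_weight_nonneg)
    finally show ?thesis using g mult_left_mono[of "1 - binom_cdf m i" 1 "binom_cdf m i"] by simp
  next
    case False
    have "1 - binom_cdf m i = (\<Sum>j=i..<m. binom_weight m j)"
      using assms by (intro binom_cdf_compl) auto
    also have "\<dots> \<le> (\<Sum>j=i..<m. binom_weight m i)"
      unfolding binom_weight_def
      by (intro sum_mono divide_right_mono) (use False in \<open>auto intro!: binomial_antimono\<close>)
    also have "\<dots> \<le> real m * binom_weight m i"
      using assms by (simp add: mult_right_mono binom_weight_nonneg)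
    finally show ?thesis using g mult_right_mono[of "binom_cdf m i" 1 "1 - binom_cdf m i"] by simp
  qed
qed

lemma potential_le: "w \<le> m \<Longrightarrow> potential m w \<le> real m ^ 3 * binom_cdf m w"
  unfolding potential_def
  by (auto intro!: sum_nonneg mult_nonneg_nonneg tail_ratio_nonneg binom_cdf_mono)

text \<open>The subtracted sum has fewer than \<open>m\<close> terms, each at most
  \<open>m ^ 2 * binom_cdf m w\<close>. This is where the coefficient \<open>m ^ 3\<close> comes
  from.\<close>

lemma potential_nonneg:
  assumes "0 < m" "w \<le> m" shows "0 \<le> potential m w"
proof -
  let ?g = "binom_cdf m"
  have term_le: "tail_ratio m i * (?g w - ?g i) \<le> real m ^ 2 * ?g w" if i: "i \<in> {1..<w}" for i
  proof -
    have im: "i < m" "0 < i" using i assms by auto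
    have c: "0 < binom_weight m i" using im by (intro binom_weight_pos) simp
    \<comment> \<open>Since \<open>?g w \<le> 1\<close>, the difference \<open>?g w - ?g i\<close>
      is at most \<open>?g w * (1 - ?g i)\<close>. This pulls out the small factor
      \<open>?g w\<close> and leaves a product to which \<open>cdf_product_le\<close>
      applies.\<close>
    have "?g w * ?g i \<le> ?g i"
      using mult_right_mono[of "?g w" 1 "?g i"] binom_cdf_le_1[OF assms] binom_cdf_nonneg by simp
    then have "?g w - ?g i \<le> ?g w * (1 - ?g i)" by (simp add: algebra_simps)
    then have "tail_ratio m i * (?g w - ?g i) \<le> tail_ratio m i * (?g w * (1 - ?g i))"
      by (rule mult_left_mono[OF _ tail_ratio_nonneg])
    also have "\<dots> = real m * (?g i * (1 - ?g i) / binom_weight m i) * ?g w / real i"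
      by (simp add: tail_ratio_def mult_ac)
    also have "\<dots> \<le> real m * real m * ?g w / real i"
      using cdf_product_le[OF im(1)] c
      by (intro divide_right_mono mult_right_mono mult_left_mono binom_cdf_nonneg)
         (auto simp: pos_divide_le_eq)
    also have "\<dots> \<le> real m * real m * ?g w / 1"
      using im by (intro divide_left_mono mult_nonneg_nonneg binom_cdf_nonneg) auto
    finally show ?thesis by (simp add: power2_eq_square)
  qed
  have "(\<Sum>i=1..<w. tail_ratio m i * (?g w - ?g i)) \<le> (\<Sum>i=1..<w. real m ^ 2 * ?g w)"
    by (rule sum_mono) (rule term_le)
  also have "\<dots> = real (w - 1) * (real m ^ 2 * ?g w)" by simp
  also have "\<dots> \<le> real m * (real m ^ 2 * ?g w)"
    using assms by (intro mult_right_mono mult_nonneg_nonneg binom_cdf_nonneg) auto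
  finally show ?thesis by (simp add: potential_def power3_eq_cube power2_eq_square mult.assoc)
qed

text \<open>The leading term of \<open>potential\<close> is harmonic, so it remains to see that the
  subtracted sum \<open>F\<close> grows by exactly \<open>binom_cdf m w\<close> on average over one
  step.\<close>

lemma potential_step:
  assumes "0 < w" "w < m"
  shows "binom_cdf m w + (real w / real m * potential m (Suc w) + real (m - w) / real m * potential m (w - 1))
    = potential m w"
proof -
  obtain v where v: "w = Suc v" using assms by (cases w) auto
  then have v1: "w - 1 = v" by simp
  let ?g = "binom_cdf m" and ?c = "binom_weight m" and ?a = "tail_ratio m"
  define F where "F u = (\<Sum>i=1..<u. ?a i * (?g u - ?g i))" for u
  have F_Suc: "F (Suc u) = F u + ?c u * (\<Sum>i=1..<Suc u. ?a i)" for u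
  proof (cases u)
    case 0 then show ?thesis by (simp add: F_def)
  next
    case (Suc u')
    have split: "(\<Sum>i=1..<Suc u. h i) = (\<Sum>i=1..<u. h i) + h u" for h :: "nat \<Rightarrow> real"
      using Suc by simp
    have "(\<Sum>i=1..<u. ?a i * (?g (Suc u) - ?g i)) = (\<Sum>i=1..<u. ?a i * (?g u - ?g i) + ?c u * ?a i)"
      by (intro sum.cong refl) (simp add: binom_cdf_Suc algebra_simps)
    also have "\<dots> = F u + ?c u * (\<Sum>i=1..<u. ?a i)"
      by (simp only: F_def sum.distrib sum_distrib_left)
    finally show ?thesis
      by (simp only: F_def split binom_cdf_Suc) (simp add: algebra_simps)
  qed
  have s: "real w * ?c w = real (m - w) * ?c v"
    using binom_weight_step[of v m] assms v by simp
  have cw: "0 < ?c w" using assms by (intro binom_weight_pos)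
  have total: "real w + real (m - w) = real m" using assms by simp
  have aw: "real w * ?c w * ?a w = real m * ?g w"
    using assms cw by (simp add: tail_ratio_def)
  \<comment> \<open>By \<open>F_Suc\<close>, the increments of \<open>F\<close> at \<open>w\<close>
    and \<open>v\<close> are weights times partial sums of \<open>?a\<close> that differ only by
    \<open>?a w\<close>. The common part cancels by \<open>s\<close>, and \<open>tail_ratio\<close>
    is chosen so that the remainder is \<open>m * ?g w\<close>.\<close>
  have "real w * F (Suc w) + real (m - w) * F v =
     (real w + real (m - w)) * F w + real w * ?c w * ?a w
     + (real w * ?c w - real (m - w) * ?c v) * (\<Sum>i=1..<w. ?a i)"
    by (simp add: F_Suc v algebra_simps)
  also have "\<dots> = real m * (F w + ?g w)"
    by (simp only: total aw) (simp add: s ring_distribs)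
  finally have "(real w * F (Suc w) + real (m - w) * F v) / real m = F w + ?g w"
    using assms by simp
  then have F_step: "real w / real m * F (Suc w) + real (m - w) / real m * F (w - 1) = F w + ?g w"
    by (simp only: v1 add_divide_distrib times_divide_eq_left)
  have P: "potential m u = real m ^ 3 * ?g u - F u" for u by (simp add: potential_def F_def)
  have "?g w + (real w / real m * potential m (Suc w) + real (m - w) / real m * potential m (w - 1))
    = ?g w + real m ^ 3 * (real w / real m * ?g (Suc w) + real (m - w) / real m * ?g (w - 1))
      - (real w / real m * F (Suc w) + real (m - w) / real m * F (w - 1))"
    unfolding P by (simp only: ring_distribs) (simp add: algebra_simps)
  also have "\<dots> = potential m w"
    using binom_cdf_harmonic[OF assms] F_step by (simp add: P)
  finally show ?thesis .
qed

section \<open>Exponential decay of the binomial tail below the centre\<close>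

lemma binom_cdf_chernoff:
  assumes "0 < m" "0 < t" "t \<le> 1"
  shows "binom_cdf m w \<le> ((1 + t) / 2) ^ (m - 1) / t ^ w"
proof -
  \<comment> \<open>For \<open>j < w\<close> the factor \<open>t ^ w\<close> is at most
    \<open>t ^ j\<close>, as \<open>t \<le> 1\<close>. Completing the sum to all \<open>j\<close>
    gives the generating function of the binomial distribution at \<open>t\<close>.\<close>
  have "binom_cdf m w * t ^ w \<le> (\<Sum>j<w. binom_weight m j * t ^ j)"
    unfolding binom_cdf_def sum_distrib_right
    using assms by (intro sum_mono mult_left_mono binom_weight_nonneg power_decreasing) auto
  also have "\<dots> \<le> (\<Sum>j\<le>m - 1. binom_weight m j * t ^ j)"
  proof (cases "w \<le> m")
    case True
    then show ?thesis using assms by (intro sum_mono2) (auto simp: binom_weight_nonneg)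
  next
    case False
    then show ?thesis
      by (intro eq_refl[OF sum.mono_neutral_right]) (auto simp: binom_weight_def)
  qed
  also have "\<dots> = ((1 + t) / 2) ^ (m - 1)"
    using binomial_ring[of t 1 "m - 1"]
    by (simp add: binom_weight_def power_divide sum_divide_distrib add.commute)
  finally show ?thesis using assms by (simp add: pos_le_divide_eq)
qed

text \<open>The logarithm of the rate is 0 at \<open>t = 1\<close> and has the positive derivative
  \<open>1 / 2 - y\<close> there, so it is negative slightly to the left of 1.\<close>

lemma chernoff_rate_lt_1:
  assumes "y < 1 / 2"
  obtains t :: real where "0 < t" "t < 1" "(1 + t) / 2 * t powr (- y) < 1"
proof -
  let ?f = "\<lambda>t::real. ln (1 + t) - ln 2 - y * ln t"
  have "DERIV ?f 1 :> 1 / 2 - y" by (auto intro!: derivative_eq_intros)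
  then obtain d where d: "0 < d" "\<And>h. 0 < h \<Longrightarrow> h < d \<Longrightarrow> ?f (1 - h) < ?f 1"
    using DERIV_pos_inc_left[of ?f "1 / 2 - y" 1] assms by auto
  \<comment> \<open>Halving \<open>d\<close> keeps the offset strictly inside the interval given by
    the derivative; the cap \<open>1 / 2\<close> keeps \<open>t\<close> positive.\<close>
  define t where "t = 1 - min (d / 2) (1 / 2)"
  have t: "0 < t" "t < 1" using d(1) by (auto simp: t_def min_def)
  have "?f t < 0" using d(2)[of "min (d / 2) (1 / 2)"] d(1) by (auto simp: t_def min_def)
  then have "ln ((1 + t) / 2 * t powr (- y)) < 0"
    using t by (simp add: ln_mult ln_div ln_powr)
  then have "(1 + t) / 2 * t powr (- y) < 1" using t by (simp add: ln_less_zero_iff)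
  then show thesis using that t by blast
qed

lemma binom_cdf_floor_tendsto_0:
  assumes "y < 1 / 2"
  shows "(\<lambda>m. real m ^ 3 * binom_cdf m (nat \<lfloor>y * real m\<rfloor>)) \<longlonglongrightarrow> 0"
proof -
  obtain t where t: "0 < t" "t < 1" and r: "(1 + t) / 2 * t powr (- y) < 1"
    using chernoff_rate_lt_1[OF assms] .
  define q where "q = (1 + t) / 2 * t powr (- y)"
  have q: "0 < q" "q < 1" using t r by (auto simp: q_def)
  \<comment> \<open>With a cube root of the rate, \<open>m ^ 3 * q ^ m\<close> is the cube of
    \<open>m * r ^ m\<close>, whose limit is known.\<close>
  define r where "r = root 3 q"
  have "0 < r" "r < 1" using q by (simp_all add: r_def)
  then have "(\<lambda>m. 2 * (real m * r ^ m) ^ 3) \<longlonglongrightarrow> 2 * 0 ^ 3"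
    by (intro tendsto_intros powser_times_n_limit_0) simp
  moreover have "(real m * r ^ m) ^ 3 = real m ^ 3 * q ^ m" for m
  proof -
    have "(r ^ m) ^ 3 = (r ^ 3) ^ m" by (simp add: mult.commute flip: power_mult)
    also have "r ^ 3 = q" using q by (simp add: r_def)
    finally show ?thesis by (simp add: power_mult_distrib)
  qed
  ultimately have lim: "(\<lambda>m. 2 * (real m ^ 3 * q ^ m)) \<longlonglongrightarrow> 0" by simp
  have bound: "real m ^ 3 * binom_cdf m (nat \<lfloor>y * real m\<rfloor>) \<le> 2 * (real m ^ 3 * q ^ m)" if m: "0 < m" for m
  proof (cases "0 \<le> y")
    case True
    let ?w = "nat \<lfloor>y * real m\<rfloor>"
    have "real ?w \<le> y * real m" using True by simp
    have "binom_cdf m ?w \<le> ((1 + t) / 2) ^ (m - 1) / t ^ ?w"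
      using m t by (intro binom_cdf_chernoff) auto
    also have "\<dots> = ((1 + t) / 2) ^ (m - 1) * t powr (- real ?w)"
      by (simp only: powr_minus powr_realpow[OF t(1)] divide_inverse)
    also have "\<dots> \<le> (2 * ((1 + t) / 2) ^ m) * t powr (- (y * real m))"
    proof (intro mult_mono)
      have "((1 + t) / 2) ^ (m - 1) * 1 \<le> ((1 + t) / 2) ^ (m - 1) * (1 + t)"
        using t by (intro mult_left_mono) auto
      also have "\<dots> = 2 * ((1 + t) / 2) ^ Suc (m - 1)" by simp
      finally show "((1 + t) / 2) ^ (m - 1) \<le> 2 * ((1 + t) / 2) ^ m" using m by simp
      show "t powr (- real ?w) \<le> t powr (- (y * real m))"
        using t \<open>real ?w \<le> y * real m\<close> by (intro powr_mono') auto
    qed (use t in auto)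
    also have "\<dots> = 2 * q ^ m"
      using powr_power[of t "- y" m] t
      unfolding q_def power_mult_distrib[of "(1 + t) / 2"] by (simp add: mult.commute)
    finally have "real m ^ 3 * binom_cdf m ?w \<le> real m ^ 3 * (2 * q ^ m)"
      by (rule mult_left_mono) simp
    then show ?thesis by (simp only: mult.left_commute)
  next
    case False
    \<comment> \<open>For negative \<open>y\<close>, \<open>nat\<close> truncates to 0 and the tail
      is an empty sum.\<close>
    then have "nat \<lfloor>y * real m\<rfloor> = 0" using m mult_nonpos_nonneg[of y "real m"] by (simp add: floor_le_iff)
    then show ?thesis using q by simp
  qed
  show ?thesis
    by (rule tendsto_sandwich[OF _ _ tendsto_const lim])
       (auto intro!: always_eventually eventually_sequentiallyI[of 1] bound simp: binom_cdf_nonneg)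
qed

subsection \<open>The urn process\<close>

definition active :: "nat \<times> nat \<Rightarrow> nat \<Rightarrow> nat stream set" where
  "active s n = {\<omega>. fst (urn s n \<omega>) \<noteq> 0 \<and> snd (urn s n \<omega>) \<noteq> 0}"

text \<open>Fixing a horizon \<open>n\<close> permits induction on \<open>n\<close>. Absorbed states
  persist, so these events increase with \<open>n\<close> and the probability of an eventual win is
  a supremum.\<close>

definition white_by :: "nat \<times> nat \<Rightarrow> nat \<Rightarrow> nat stream set" where
  "white_by s n = {\<omega>. snd (urn s n \<omega>) = 0}"

definition black_by :: "nat \<times> nat \<Rightarrow> nat \<Rightarrow> nat stream set" where
  "black_by s n = {\<omega>. fst (urn s n \<omega>) = 0}"

definition white_wins :: "nat \<times> nat \<Rightarrow> nat stream set" where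
  "white_wins s = (\<Union>n. white_by s n)"

definition black_wins :: "nat \<times> nat \<Rightarrow> nat stream set" where
  "black_wins s = (\<Union>n. black_by s n)"

text \<open>The recursion of \<open>urn\<close> peels off the last draw; first-step analysis has to
  peel off the first.\<close>

lemma urn_Stream: "urn s (Suc n) (d ## \<omega>) = urn (urn_step s d) n \<omega>"
  by (induction n) simp_all

lemma urn_step_absorbed: "fst s = 0 \<or> snd s = 0 \<Longrightarrow> urn_step s d = s"
  by (cases s) (auto simp: urn_step_def)

lemma urn_absorbed:
  assumes "fst (urn s n \<omega>) = 0 \<or> snd (urn s n \<omega>) = 0" "n \<le> k"
  shows "urn s k \<omega> = urn s n \<omega>"
  using assms(2) by (induction k rule: dec_induct) (use assms(1) in \<open>simp_all add: urn_step_absorbed\<close>)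

lemma urn_absorbed_start: "fst s = 0 \<or> snd s = 0 \<Longrightarrow> urn s n \<omega> = s"
  using urn_absorbed[of s 0 \<omega> n] by simp

lemma urn_total: "fst (urn s n \<omega>) + snd (urn s n \<omega>) = fst s + snd s"
  by (induction n) (auto simp: urn_step_def split: prod.split)

lemma sets_draws [measurable_cong]: "sets (draws s) = sets (stream_space (count_space UNIV))"
  unfolding draws_def by (rule sets_stream_space_cong) simp

lemma space_draws [simp]: "space (draws s) = UNIV"
  by (simp add: draws_def space_stream_space)

lemma prob_space_draws: "prob_space (draws s)"
  unfolding draws_def by (rule prob_space.prob_space_stream_space[OF prob_space_measure_pmf])

lemma measurable_urn [measurable]: "urn s n \<in> measurable (draws t) (count_space UNIV)"
proof (induction n)
  case 0
  have "urn s 0 = (\<lambda>_. s)" by (simp add: fun_eq_iff)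
  then show ?case by simp
next
  case (Suc n)
  have "(\<lambda>\<omega>. urn_step (urn s n \<omega>) (\<omega> !! n)) \<in> measurable (draws t) (count_space UNIV)"
    by (rule measurable_compose_countable[OF _ Suc, where f = "\<lambda>p \<omega>. urn_step p (\<omega> !! n)"]) measurable
  then show ?case by (simp cong: measurable_cong)
qed

lemma sets_active [measurable]: "active s n \<in> sets (draws t)"
  and sets_white_by [measurable]: "white_by s n \<in> sets (draws t)"
  and sets_black_by [measurable]: "black_by s n \<in> sets (draws t)"
proof -
  have "urn s n -` A \<inter> space (draws t) \<in> sets (draws t)" for A
    by (rule measurable_sets[OF measurable_urn]) simp
  from this[of "{p. fst p \<noteq> 0 \<and> snd p \<noteq> 0}"] this[of "{p. snd p = 0}"] this[of "{p. fst p = 0}"]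
  show "active s n \<in> sets (draws t)" "white_by s n \<in> sets (draws t)" "black_by s n \<in> sets (draws t)"
    by (simp_all add: active_def white_by_def black_by_def vimage_def)
qed

lemma sets_wins [measurable]: "white_wins s \<in> sets (draws t)" "black_wins s \<in> sets (draws t)"
  unfolding white_wins_def black_wins_def by measurable

text \<open>First-step analysis: conditioning on the first label groups the draws into
  \<open>w\<close> white and \<open>b\<close> black ones. The family \<open>B\<close>, indexed by
  the state after the draw, lets one lemma serve all events below.\<close>

lemma emeasure_draws_step:
  assumes "0 < w" "0 < b" and A: "A \<in> sets (draws (w, b))"
    and B: "\<And>d \<omega>. d ## \<omega> \<in> A \<longleftrightarrow> \<omega> \<in> B (urn_step (w, b) d)"
  shows "emeasure (draws (w, b)) A =
    ennreal (real w / real (w + b)) * emeasure (draws (w + 1, b - 1)) (B (w + 1, b - 1)) +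
    ennreal (real b / real (w + b)) * emeasure (draws (w - 1, b + 1)) (B (w - 1, b + 1))"
proof -
  let ?D = "draws (w, b)" and ?p = "pmf_of_set {..<w + b}"
  \<comment> \<open>\<open>draws\<close> depends on a state only through its total, which a step
    preserves, so both successors share the measure \<open>?D\<close>.\<close>
  have D: "draws (w + 1, b - 1) = ?D" "draws (w - 1, b + 1) = ?D"
    using assms(1,2) by (simp_all add: draws_def)
  have weight: "ennreal (real v) / ennreal (real (w + b)) = ennreal (real v / real (w + b))" for v
    by (rule divide_ennreal) (use assms(1) in auto)
  define x where "x = emeasure ?D (B (w + 1, b - 1))"
  define y where "y = emeasure ?D (B (w - 1, b + 1))"
  have "emeasure ?D A = (\<integral>\<^sup>+d. emeasure ?D {\<omega> \<in> space ?D. d ## \<omega> \<in> A} \<partial>measure_pmf ?p)"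
    using prob_space.emeasure_stream_space[OF prob_space_measure_pmf, of A ?p] A
    by (simp add: draws_def)
  also have "\<dots> = (\<integral>\<^sup>+d. emeasure ?D (B (urn_step (w, b) d)) \<partial>measure_pmf ?p)"
    by (simp add: B)
  also have "\<dots> = (\<Sum>d<w + b. emeasure ?D (B (urn_step (w, b) d))) / ennreal (real (w + b))"
    using assms(1) by (subst nn_integral_pmf_of_set) (auto simp: ennreal_of_nat_eq_real_of_nat lessThan_empty_iff)
  also have "{..<w + b} = {..<w} \<union> {w..<w + b}" by auto
  also have "(\<Sum>d\<in>{..<w} \<union> {w..<w + b}. emeasure ?D (B (urn_step (w, b) d))) =
     (\<Sum>d<w. emeasure ?D (B (urn_step (w, b) d))) + (\<Sum>d=w..<w + b. emeasure ?D (B (urn_step (w, b) d)))"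
    by (rule sum.union_disjoint) auto
  also have "(\<Sum>d<w. emeasure ?D (B (urn_step (w, b) d))) = (\<Sum>d<w. x)"
    using assms(1,2) by (intro sum.cong) (auto simp: urn_step_def x_def)
  also have "(\<Sum>d=w..<w + b. emeasure ?D (B (urn_step (w, b) d))) = (\<Sum>d=w..<w + b. y)"
    using assms(1,2) by (intro sum.cong) (auto simp: urn_step_def y_def)
  also have "((\<Sum>d<w. x) + (\<Sum>d=w..<w + b. y)) / ennreal (real (w + b)) =
      (ennreal (real w) / ennreal (real (w + b))) * x + (ennreal (real b) / ennreal (real (w + b))) * y"
    by (simp only: sum_constant card_lessThan card_atLeastLessThan diff_add_inverse
        ennreal_of_nat_eq_real_of_nat divide_ennreal_def distrib_left distrib_right mult_ac)
  also have "\<dots> = ennreal (real w / real (w + b)) * x + ennreal (real b / real (w + b)) * y"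
    by (simp only: weight)
  finally show ?thesis by (simp only: D x_def y_def)
qed

lemma white_by_0: "white_by s 0 = (if snd s = 0 then UNIV else {})"
  and black_by_0: "black_by s 0 = (if fst s = 0 then UNIV else {})"
  and active_0: "active s 0 = (if fst s = 0 \<or> snd s = 0 then {} else UNIV)"
  by (auto simp: white_by_def black_by_def active_def)

lemma
  assumes "fst s = 0 \<or> snd s = 0"
  shows white_by_absorbed: "white_by s n = white_by s 0"
    and black_by_absorbed: "black_by s n = black_by s 0"
    and active_absorbed: "active s n = {}"
  using assms by (simp_all add: white_by_def black_by_def active_def urn_absorbed_start)

lemma
  assumes "0 < w" "0 < b"
  shows white_by_Stream: "d ## \<omega> \<in> white_by (w, b) (Suc n) \<longleftrightarrow> \<omega> \<in> white_by (urn_step (w, b) d) n"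
    and black_by_Stream: "d ## \<omega> \<in> black_by (w, b) (Suc n) \<longleftrightarrow> \<omega> \<in> black_by (urn_step (w, b) d) n"
    and active_Stream: "d ## \<omega> \<in> active (w, b) (Suc n) \<longleftrightarrow> \<omega> \<in> active (urn_step (w, b) d) n"
  by (simp_all only: white_by_def black_by_def active_def mem_Collect_eq urn_Stream)

lemma
  assumes "0 < w" "0 < b"
  shows white_wins_Stream: "d ## \<omega> \<in> white_wins (w, b) \<longleftrightarrow> \<omega> \<in> white_wins (urn_step (w, b) d)"
    and black_wins_Stream: "d ## \<omega> \<in> black_wins (w, b) \<longleftrightarrow> \<omega> \<in> black_wins (urn_step (w, b) d)"
proof -
  \<comment> \<open>Splitting off time 0 suffices: with both colours present, nobody has won at time
    0.\<close>
  have E: "(\<exists>n. P n) \<longleftrightarrow> P 0 \<or> (\<exists>n. P (Suc n))" for P :: "nat \<Rightarrow> bool" by (metis nat.exhaust)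
  show "d ## \<omega> \<in> white_wins (w, b) \<longleftrightarrow> \<omega> \<in> white_wins (urn_step (w, b) d)"
    using assms unfolding white_wins_def UN_iff bex_UNIV
    by (subst E) (simp add: white_by_0 white_by_Stream)
  show "d ## \<omega> \<in> black_wins (w, b) \<longleftrightarrow> \<omega> \<in> black_wins (urn_step (w, b) d)"
    using assms unfolding black_wins_def UN_iff bex_UNIV
    by (subst E) (simp add: black_by_0 black_by_Stream)
qed

lemma incseq_white_by: "incseq (white_by s)" and incseq_black_by: "incseq (black_by s)"
  by (auto intro!: incseq_SucI simp: white_by_def black_by_def urn_step_absorbed)

lemma emeasure_white_wins: "emeasure (draws s) (white_wins s) = (SUP n. emeasure (draws s) (white_by s n))"
  unfolding white_wins_def by (intro SUP_emeasure_incseq[symmetric] incseq_white_by) auto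

lemma emeasure_black_wins: "emeasure (draws s) (black_wins s) = (SUP n. emeasure (draws s) (black_by s n))"
  unfolding black_wins_def by (intro SUP_emeasure_incseq[symmetric] incseq_black_by) auto

lemma emeasure_draws_UNIV [simp]: "emeasure (draws s) UNIV = 1"
  using prob_space.emeasure_space_1[OF prob_space_draws, of s] by simp

section \<open>Exchange of the two colours\<close>

lemma emeasure_black_by_swap:
  "emeasure (draws (w, b)) (black_by (w, b) n) = emeasure (draws (b, w)) (white_by (b, w) n)"
proof (induction n arbitrary: w b)
  case 0
  then show ?case by (simp add: white_by_0 black_by_0)
next
  case (Suc n)
  show ?case
  proof (cases "0 < w \<and> 0 < b")
    case True
    \<comment> \<open>Instead of relabelling the draws, both sides are expanded by the first step;
      the expansions agree up to the order of the two summands.\<close>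
    then show ?thesis
      by (simp add: emeasure_draws_step[where B = "\<lambda>s. black_by s n"] black_by_Stream
          emeasure_draws_step[where B = "\<lambda>s. white_by s n"] white_by_Stream Suc.IH add.commute)
  next
    case False
    then show ?thesis
      using black_by_absorbed[of "(w, b)" "Suc n"] white_by_absorbed[of "(b, w)" "Suc n"]
      by (auto simp: white_by_0 black_by_0)
  qed
qed

lemma emeasure_black_wins_swap:
  "emeasure (draws (w, b)) (black_wins (w, b)) = emeasure (draws (b, w)) (white_wins (b, w))"
  by (simp add: emeasure_black_wins emeasure_white_wins emeasure_black_by_swap)

lemma emeasure_active_black_wins_swap:
  "emeasure (draws (w, b)) (active (w, b) n \<inter> black_wins (w, b)) =
   emeasure (draws (b, w)) (active (b, w) n \<inter> white_wins (b, w))"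
proof (induction n arbitrary: w b)
  case 0
  then show ?case by (auto simp: active_0 emeasure_black_wins_swap)
next
  case (Suc n)
  show ?case
  proof (cases "0 < w \<and> 0 < b")
    case True
    then show ?thesis
      by (simp add: emeasure_draws_step[where B = "\<lambda>s. active s n \<inter> black_wins s"] black_wins_Stream
          emeasure_draws_step[where B = "\<lambda>s. active s n \<inter> white_wins s"] white_wins_Stream active_Stream
          Suc.IH add.commute)
  next
    case False
    then show ?thesis
      using active_absorbed[of "(w, b)" "Suc n"] active_absorbed[of "(b, w)" "Suc n"] by auto
  qed
qed

text \<open>Comparison principle: by induction on the horizon, since the transition weights are
  nonnegative, a supersolution \<open>V\<close> dominates every iterate. Here \<open>\<phi>\<close>
  will be a win probability (\<open>r = 0\<close>) or a truncated expected time.\<close>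

lemma supersolution_bound:
  fixes \<phi> :: "nat \<Rightarrow> nat \<times> nat \<Rightarrow> ennreal" and V r :: "nat \<Rightarrow> real"
  assumes m: "0 < m"
    and V: "\<And>w. w \<le> m \<Longrightarrow> 0 \<le> V w" and r: "\<And>w. w \<le> m \<Longrightarrow> 0 \<le> r w"
    and super: "\<And>w. 0 < w \<Longrightarrow> w < m \<Longrightarrow>
      r w + (real w / real m * V (Suc w) + real (m - w) / real m * V (w - 1)) \<le> V w"
    and start: "\<And>w b. w + b = m \<Longrightarrow> \<phi> 0 (w, b) \<le> ennreal (V w)"
    and boundary: "\<And>n w b. w + b = m \<Longrightarrow> w = 0 \<or> b = 0 \<Longrightarrow> \<phi> n (w, b) \<le> ennreal (V w)"
    and step: "\<And>n w b. w + b = m \<Longrightarrow> 0 < w \<Longrightarrow> 0 < b \<Longrightarrow> \<phi> (Suc n) (w, b) \<le>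
      ennreal (r w) + (ennreal (real w / real (w + b)) * \<phi> n (w + 1, b - 1)
        + ennreal (real b / real (w + b)) * \<phi> n (w - 1, b + 1))"
    and wb: "w + b = m"
  shows "\<phi> n (w, b) \<le> ennreal (V w)"
  using wb
proof (induction n arbitrary: w b)
  case 0
  then show ?case by (rule start)
next
  case (Suc n)
  show ?case
  proof (cases "0 < w \<and> 0 < b")
    case True
    have b: "b = m - w" using Suc.prems by simp
    have "\<phi> (Suc n) (w, b) \<le> ennreal (r w) + (ennreal (real w / real m) * \<phi> n (w + 1, b - 1)
        + ennreal (real b / real m) * \<phi> n (w - 1, b + 1))"
      using step[of w b n] True Suc.prems by simp
    also have "\<dots> \<le> ennreal (r w) + (ennreal (real w / real m) * ennreal (V (Suc w))
        + ennreal (real b / real m) * ennreal (V (w - 1)))"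
      using Suc.IH[of "w + 1" "b - 1"] Suc.IH[of "w - 1" "b + 1"] True Suc.prems
      by (intro add_mono mult_left_mono order_refl) auto
    also have "\<dots> = ennreal (r w + (real w / real m * V (Suc w) + real (m - w) / real m * V (w - 1)))"
    proof -
      have nonneg: "0 \<le> r w" "0 \<le> real w / real m * V (Suc w)" "0 \<le> real b / real m * V (w - 1)"
        using V[of "Suc w"] V[of "w - 1"] r[of w] True Suc.prems by auto
      show ?thesis
        using nonneg(1,2,3) True
        by (simp only: b[symmetric] ennreal_plus[OF nonneg(1) add_nonneg_nonneg[OF nonneg(2,3)]]
            ennreal_plus[OF nonneg(2,3)] ennreal_mult'[OF divide_nonneg_nonneg[OF of_nat_0_le_iff of_nat_0_le_iff]])
    qed
    also have "\<dots> \<le> ennreal (V w)"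
      using super[of w] True Suc.prems by (intro ennreal_leI) auto
    finally show ?thesis .
  next
    case False
    then show ?thesis using boundary[of w b "Suc n"] Suc.prems by auto
  qed
qed

text \<open>The harmonic function equals 0 and 1 at the ends, so it dominates the win probability at
  each finite horizon. The upper bound does not presuppose almost sure absorption.\<close>

lemma emeasure_white_wins_le:
  assumes "w + b = m" "0 < m"
  shows "emeasure (draws (w, b)) (white_wins (w, b)) \<le> ennreal (binom_cdf m w)"
proof -
  have "emeasure (draws (w, b)) (white_by (w, b) n) \<le> ennreal (binom_cdf m w)" for n
  proof (rule supersolution_bound[where \<phi> = "\<lambda>n s. emeasure (draws s) (white_by s n)"
        and r = "\<lambda>_. 0" and V = "binom_cdf m", OF assms(2)])
    have *: "emeasure (draws (w, b)) (white_by (w, b) n) \<le> ennreal (binom_cdf m w)"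
      if "w + b = m" "w = 0 \<or> b = 0 \<or> n = 0" for n w b
      using that assms(2) white_by_absorbed[of "(w, b)" n]
      by (cases "n = 0") (auto simp: white_by_0 binom_cdf_full)
    show "emeasure (draws (w, b)) (white_by (w, b) n) \<le> ennreal (binom_cdf m w)"
      if "w + b = m" "w = 0 \<or> b = 0" for n w b using * that by blast
    show "emeasure (draws (w, b)) (white_by (w, b) 0) \<le> ennreal (binom_cdf m w)"
      if "w + b = m" for w b using * that by blast
    show "0 + (real w / real m * binom_cdf m (Suc w) + real (m - w) / real m * binom_cdf m (w - 1)) \<le> binom_cdf m w"
      if "0 < w" "w < m" for w using binom_cdf_harmonic[OF that] by simp
  qed (auto simp: binom_cdf_nonneg assms(1) white_by_Stream
      emeasure_draws_step[where B = "\<lambda>s. white_by s n" for n])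
  then show ?thesis unfolding emeasure_white_wins by (rule SUP_least)
qed

lemma sum_emeasure_draws_step:
  assumes "0 < w" "0 < b"
    and A: "\<And>k. A k \<in> sets (draws (w, b))"
    and B: "\<And>k d \<omega>. d ## \<omega> \<in> A (Suc k) \<longleftrightarrow> \<omega> \<in> B (urn_step (w, b) d) k"
  shows "(\<Sum>k<Suc n. emeasure (draws (w, b)) (A k)) = emeasure (draws (w, b)) (A 0) +
    (ennreal (real w / real (w + b)) * (\<Sum>k<n. emeasure (draws (w + 1, b - 1)) (B (w + 1, b - 1) k)) +
     ennreal (real b / real (w + b)) * (\<Sum>k<n. emeasure (draws (w - 1, b + 1)) (B (w - 1, b + 1) k)))"
proof -
  have "emeasure (draws (w, b)) (A (Suc k)) =
    ennreal (real w / real (w + b)) * emeasure (draws (w + 1, b - 1)) (B (w + 1, b - 1) k) +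
    ennreal (real b / real (w + b)) * emeasure (draws (w - 1, b + 1)) (B (w - 1, b + 1) k)" for k
    by (rule emeasure_draws_step[where B = "\<lambda>s. B s k", OF assms(1,2) A B])
  then show ?thesis
    by (simp only: sum.lessThan_Suc_shift sum.distrib sum_distrib_left)
qed

text \<open>The series is the expected absorption time on the event that white wins. Its term at
  \<open>k = 0\<close> is a win probability, bounded by \<open>binom_cdf m w\<close>; hence the
  choice of \<open>r\<close>.\<close>

lemma suminf_active_white_wins_le:
  assumes "w + b = m" "0 < m"
  shows "(\<Sum>k. emeasure (draws (w, b)) (active (w, b) k \<inter> white_wins (w, b))) \<le> ennreal (potential m w)"
proof -
  have "(\<Sum>k<n. emeasure (draws (w, b)) (active (w, b) k \<inter> white_wins (w, b))) \<le> ennreal (potential m w)" for n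
  proof (rule supersolution_bound[where \<phi> = "\<lambda>n s. \<Sum>k<n. emeasure (draws s) (active s k \<inter> white_wins s)"
        and r = "binom_cdf m" and V = "potential m", OF assms(2)])
    fix n w b assume wb: "w + b = m" "0 < w" "0 < b"
    have "emeasure (draws (w, b)) (active (w, b) 0 \<inter> white_wins (w, b)) \<le> ennreal (binom_cdf m w)"
      using wb emeasure_white_wins_le[of w b m] by (simp add: active_0)
    then show "(\<Sum>k<Suc n. emeasure (draws (w, b)) (active (w, b) k \<inter> white_wins (w, b))) \<le>
      ennreal (binom_cdf m w) +
      (ennreal (real w / real (w + b)) *
         (\<Sum>k<n. emeasure (draws (w + 1, b - 1)) (active (w + 1, b - 1) k \<inter> white_wins (w + 1, b - 1))) +
       ennreal (real b / real (w + b)) *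
         (\<Sum>k<n. emeasure (draws (w - 1, b + 1)) (active (w - 1, b + 1) k \<inter> white_wins (w - 1, b + 1))))"
      by (subst sum_emeasure_draws_step[where B = "\<lambda>s k. active s k \<inter> white_wins s"])
         (use wb in \<open>auto simp: active_Stream white_wins_Stream intro: add_right_mono\<close>)
  next
    show "binom_cdf m w + (real w / real m * potential m (Suc w) + real (m - w) / real m * potential m (w - 1))
        \<le> potential m w" if "0 < w" "w < m" for w
      using potential_step[OF that] by simp
  qed (auto simp: potential_nonneg binom_cdf_nonneg active_absorbed assms)
  then show ?thesis by (rule suminf_le_const[OF summableI])
qed

text \<open>Since \<open>binom_cdf m w + binom_cdf m (m - w) = 1\<close>, the potential plus its
  reflection solves \<open>V = 1 + P V\<close>. This makes the expected absorption time
  finite.\<close>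

lemma suminf_active_le:
  assumes "w + b = m" "0 < m"
  shows "(\<Sum>k. emeasure (draws (w, b)) (active (w, b) k)) \<le> ennreal (potential m w + potential m (m - w))"
proof -
  have "(\<Sum>k<n. emeasure (draws (w, b)) (active (w, b) k)) \<le> ennreal (potential m w + potential m (m - w))" for n
  proof (rule supersolution_bound[where \<phi> = "\<lambda>n s. \<Sum>k<n. emeasure (draws s) (active s k)"
        and r = "\<lambda>_. 1" and V = "\<lambda>w. potential m w + potential m (m - w)", OF assms(2)])
    fix w assume w: "0 < w" "w < m"
    have eqs: "m - (w - 1) = Suc (m - w)" "m - Suc w = m - w - 1" "m - (m - w) = w" using w by auto
    have "binom_cdf m w + binom_cdf m (m - w) = 1" using binom_cdf_symmetric[of m w] w by simp
    then show "1 + (real w / real m * (potential m (Suc w) + potential m (m - Suc w)) +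
       real (m - w) / real m * (potential m (w - 1) + potential m (m - (w - 1)))) \<le>
       potential m w + potential m (m - w)"
      using potential_step[OF w] potential_step[of "m - w" m] w unfolding eqs by (simp add: ring_distribs)
  next
    fix n w b assume wb: "w + b = m" "0 < w" "0 < b"
    then show "(\<Sum>k<Suc n. emeasure (draws (w, b)) (active (w, b) k)) \<le>
      ennreal 1 + (ennreal (real w / real (w + b)) * (\<Sum>k<n. emeasure (draws (w + 1, b - 1)) (active (w + 1, b - 1) k)) +
       ennreal (real b / real (w + b)) * (\<Sum>k<n. emeasure (draws (w - 1, b + 1)) (active (w - 1, b + 1) k)))"
      by (subst sum_emeasure_draws_step[where B = "\<lambda>s k. active s k"])
         (auto simp: active_Stream active_0)
  qed (auto simp: potential_nonneg active_absorbed assms)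
  then show ?thesis by (rule suminf_le_const[OF summableI])
qed

subsection \<open>Absorption times\<close>

text \<open>The sets \<open>active\<close> are thus the tail events of the absorption time, which
  turns its expectations into series of probabilities.\<close>

lemma less_absorption_time_iff: "enat n < absorption_time s \<omega> \<longleftrightarrow> \<omega> \<in> active s n"
proof
  assume "enat n < absorption_time s \<omega>"
  moreover have "absorption_time s \<omega> \<le> enat n" if "\<omega> \<notin> active s n"
    unfolding absorption_time_def by (rule INF_lower) (use that in \<open>auto simp: active_def\<close>)
  ultimately show "\<omega> \<in> active s n" by fastforce
next
  assume a: "\<omega> \<in> active s n"
  have "enat (Suc n) \<le> absorption_time s \<omega>"
    unfolding absorption_time_def
  proof (rule INF_greatest)
    fix k assume k: "k \<in> {n. fst (urn s n \<omega>) = 0 \<or> snd (urn s n \<omega>) = 0}"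
    have "\<not> k \<le> n" using urn_absorbed[of s k \<omega> n] k a by (auto simp: active_def)
    then show "enat (Suc n) \<le> enat k" by simp
  qed
  then show "enat n < absorption_time s \<omega>" by (simp add: Suc_ile_eq)
qed

lemma enat_eqI:
  fixes x y :: enat
  assumes "\<And>n. enat n < x \<longleftrightarrow> enat n < y" shows "x = y"
proof -
  have "\<not> y < x" using assms by (cases y) auto
  moreover have "\<not> x < y" using assms by (cases x) auto
  ultimately show ?thesis by simp
qed

lemma measurable_absorption_time [measurable]:
  "absorption_time s \<in> measurable (draws t) (count_space UNIV)"
proof -
  have "absorption_time s -` {a} \<inter> space (draws t) \<in> sets (draws t)" for a
  proof -
    \<comment> \<open>A value in \<open>enat\<close> is determined by the naturals below it, so each
      level set is a countable combination of the sets \<open>active\<close>.\<close>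
    have "absorption_time s \<omega> = a \<longleftrightarrow> (\<forall>n. \<omega> \<in> active s n \<longleftrightarrow> enat n < a)" for \<omega>
    proof
      assume "\<forall>n. \<omega> \<in> active s n \<longleftrightarrow> enat n < a"
      then have eq: "enat n < absorption_time s \<omega> \<longleftrightarrow> enat n < a" for n
        by (simp add: less_absorption_time_iff)
      show "absorption_time s \<omega> = a" by (rule enat_eqI) (rule eq)
    qed (auto simp: less_absorption_time_iff)
    then have "absorption_time s -` {a} \<inter> space (draws t) =
      {\<omega> \<in> space (draws t). \<forall>n. \<omega> \<in> active s n \<longleftrightarrow> enat n < a}" by auto
    also have "\<dots> \<in> sets (draws t)" by measurable
    finally show ?thesis .
  qed
  then show ?thesis by (simp add: measurable_count_space_eq_countable)
qed

lemma absorbed_black_eq: "absorbed_black s = black_wins s"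
proof (intro set_eqI iffI)
  fix \<omega> assume "\<omega> \<in> absorbed_black s"
  then show "\<omega> \<in> black_wins s" by (auto simp: absorbed_black_def black_wins_def black_by_def)
next
  fix \<omega> assume "\<omega> \<in> black_wins s"
  then obtain n where n: "fst (urn s n \<omega>) = 0" by (auto simp: black_wins_def black_by_def)
  then have "\<not> enat n < absorption_time s \<omega>" by (simp add: less_absorption_time_iff active_def)
  then obtain k where k: "absorption_time s \<omega> = enat k" "k \<le> n"
    by (cases "absorption_time s \<omega>") auto
  have "\<omega> \<notin> active s k" using less_absorption_time_iff[of k s \<omega>] k by simp
  then have "urn s n \<omega> = urn s k \<omega>" using k by (intro urn_absorbed) (auto simp: active_def)
  then show "\<omega> \<in> absorbed_black s" using n k by (simp add: absorbed_black_def)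
qed

lemma T_eq: "T w b = enn2ereal (\<Sum>k. emeasure (draws (w, b)) (active (w, b) k))"
  unfolding T_def by (subst nn_integral_enat_function) (auto simp: less_absorption_time_iff)

lemma T_star_eq:
  "T_star w b = enn2ereal ((\<Sum>k. emeasure (draws (w, b)) (active (w, b) k \<inter> black_wins (w, b)))
    / emeasure (draws (w, b)) (black_wins (w, b)))"
proof -
  let ?D = "draws (w, b)" and ?B = "black_wins (w, b)"
  have meas: "absorption_time (w, b) \<in> measurable (uniform_measure ?D ?B) (count_space UNIV)"
    by measurable
  have "(\<integral>\<^sup>+ \<omega>. ennreal_of_enat (absorption_time (w, b) \<omega>) \<partial>uniform_measure ?D ?B) =
    (\<Sum>k. emeasure (uniform_measure ?D ?B) (active (w, b) k))"
    by (subst nn_integral_enat_function[OF meas]) (simp add: less_absorption_time_iff)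
  also have "\<dots> = (\<Sum>k. emeasure ?D (active (w, b) k \<inter> ?B) * inverse (emeasure ?D ?B))"
    by (simp add: Int_commute divide_ennreal_def)
  also have "\<dots> = (\<Sum>k. emeasure ?D (active (w, b) k \<inter> ?B)) * inverse (emeasure ?D ?B)"
    by simp
  finally show ?thesis by (simp add: T_star_def absorbed_black_eq divide_ennreal_def)
qed

section \<open>Almost sure absorption and splitting by the winner\<close>

lemma wins_disjoint:
  assumes "0 < w + b" shows "white_wins (w, b) \<inter> black_wins (w, b) = {}"
proof -
  have "False" if "snd (urn (w, b) n \<omega>) = 0" "fst (urn (w, b) k \<omega>) = 0" for n k \<omega>
  proof -
    \<comment> \<open>Both absorbed states persist until \<open>max n k\<close>, where the urn would
      have to be empty.\<close>
    have "urn (w, b) (max n k) \<omega> = urn (w, b) n \<omega>" "urn (w, b) (max n k) \<omega> = urn (w, b) k \<omega>"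
      using that by (auto intro!: urn_absorbed)
    then show False using urn_total[of "(w, b)" "max n k" \<omega>] that assms by simp
  qed
  then show ?thesis by (auto simp: white_wins_def black_wins_def white_by_def black_by_def)
qed

text \<open>A time with finite expectation is almost surely finite, and at a finite absorption time
  one of the colours has won.\<close>

lemma AE_absorbed:
  assumes "0 < w + b"
  shows "AE \<omega> in draws (w, b). \<omega> \<in> white_wins (w, b) \<union> black_wins (w, b)"
proof -
  let ?D = "draws (w, b)"
  have "(\<integral>\<^sup>+ \<omega>. ennreal_of_enat (absorption_time (w, b) \<omega>) \<partial>?D) =
      (\<Sum>k. emeasure ?D (active (w, b) k))"
    by (subst nn_integral_enat_function) (auto simp: less_absorption_time_iff)
  also have "\<dots> < \<infinity>"
    using suminf_active_le[OF refl assms] by (rule order.strict_trans1) simp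
  finally have "AE \<omega> in ?D. ennreal_of_enat (absorption_time (w, b) \<omega>) \<noteq> \<infinity>"
    by (intro nn_integral_PInf_AE) auto
  then show ?thesis
  proof eventually_elim
    case (elim \<omega>)
    then obtain n where "absorption_time (w, b) \<omega> = enat n"
      by (cases "absorption_time (w, b) \<omega>") auto
    then have "\<omega> \<notin> active (w, b) n" using less_absorption_time_iff[of n "(w, b)" \<omega>] by simp
    then show ?case by (auto simp: active_def white_wins_def black_wins_def white_by_def black_by_def)
  qed
qed

lemma emeasure_split_wins:
  assumes "0 < w + b" "A \<in> sets (draws (w, b))"
  shows "emeasure (draws (w, b)) A =
    emeasure (draws (w, b)) (A \<inter> white_wins (w, b)) + emeasure (draws (w, b)) (A \<inter> black_wins (w, b))"
proof -
  have [measurable]: "A \<in> sets (draws (w, b))" by fact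
  have "emeasure (draws (w, b)) A =
      emeasure (draws (w, b)) ((A \<inter> white_wins (w, b)) \<union> (A \<inter> black_wins (w, b)))"
    using AE_absorbed[OF assms(1)] by (intro emeasure_eq_AE) (auto elim!: eventually_mono)
  also have "\<dots> = emeasure (draws (w, b)) (A \<inter> white_wins (w, b)) + emeasure (draws (w, b)) (A \<inter> black_wins (w, b))"
    using wins_disjoint[OF assms(1)] by (intro plus_emeasure[symmetric]) auto
  finally show ?thesis .
qed

text \<open>
  Here \<open>p\<close> is the probability that white wins, and \<open>x\<close> and \<open>y\<close> are the expectations of the
  absorption time on the events that white, respectively black, wins.
\<close>

lemma times_decomposition:
  assumes "0 < w + b"
  obtains p x y :: real where "0 \<le> p" "p \<le> binom_cdf (w + b) w" "0 \<le> x" "x \<le> real (w + b) ^ 3 * binom_cdf (w + b) w"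
    "0 \<le> y" "y \<le> real (w + b) ^ 3"
    "w = b \<Longrightarrow> p = 1 / 2 \<and> x = y"
    "T w b = ereal (x + y)" "p < 1 \<Longrightarrow> T_star w b = ereal (y / (1 - p))"
proof -
  let ?D = "draws (w, b)" and ?W = "white_wins (w, b)" and ?B = "black_wins (w, b)"
  let ?X = "\<Sum>k. emeasure ?D (active (w, b) k \<inter> ?W)" and ?Y = "\<Sum>k. emeasure ?D (active (w, b) k \<inter> ?B)"
  \<comment> \<open>After the exchange of colours, the bound for white wins also covers
    \<open>?Y\<close>, with \<open>b\<close> in place of \<open>w\<close>.\<close>
  have swap: "?Y = (\<Sum>k. emeasure (draws (b, w)) (active (b, w) k \<inter> white_wins (b, w)))"
    by (simp add: emeasure_active_black_wins_swap)
  have X: "?X \<le> ennreal (real (w + b) ^ 3 * binom_cdf (w + b) w)"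
    using suminf_active_white_wins_le[OF refl assms]
    by (rule order_trans) (intro ennreal_leI potential_le, simp)
  have "?Y \<le> ennreal (potential (b + w) b)"
    unfolding swap using assms by (intro suminf_active_white_wins_le) auto
  also have "\<dots> \<le> ennreal (real (w + b) ^ 3)"
  proof (rule ennreal_leI)
    have "potential (b + w) b \<le> real (b + w) ^ 3 * binom_cdf (b + w) b" by (rule potential_le) simp
    also have "\<dots> \<le> real (b + w) ^ 3 * 1" using assms by (intro mult_left_mono binom_cdf_le_1) auto
    finally show "potential (b + w) b \<le> real (w + b) ^ 3" by (simp add: add.commute)
  qed
  finally have Y: "?Y \<le> ennreal (real (w + b) ^ 3)" .
  have W: "emeasure ?D ?W \<le> ennreal (binom_cdf (w + b) w)"
    by (rule emeasure_white_wins_le[OF refl assms])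
  have total: "emeasure ?D ?W + emeasure ?D ?B = 1"
    using emeasure_split_wins[OF assms, of UNIV] by (simp add: sets.top[of ?D, simplified])
  obtain p where p: "emeasure ?D ?W = ennreal p" "0 \<le> p" "p \<le> binom_cdf (w + b) w"
    using W by (cases "emeasure ?D ?W") (auto simp: top_unique binom_cdf_nonneg)
  obtain x where x: "?X = ennreal x" "0 \<le> x" "x \<le> real (w + b) ^ 3 * binom_cdf (w + b) w"
    using X by (cases ?X) (auto simp: top_unique binom_cdf_nonneg)
  obtain y where y: "?Y = ennreal y" "0 \<le> y" "y \<le> real (w + b) ^ 3"
    using Y by (cases ?Y) (auto simp: top_unique)
  obtain q where q: "emeasure ?D ?B = ennreal q" "0 \<le> q"
    using total by (cases "emeasure ?D ?B") auto
  have "ennreal (p + q) = ennreal 1" using total p q by simp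
  then have "p + q = 1" using p q by (subst (asm) ennreal_inj) auto
  then have pq: "q = 1 - p" by simp
  have "T w b = enn2ereal (?X + ?Y)"
    unfolding T_eq by (subst emeasure_split_wins[OF assms]) (simp_all add: suminf_add)
  then have T: "T w b = ereal (x + y)" using x y by (simp flip: ennreal_plus)
  have T_star: "T_star w b = ereal (y / (1 - p))" if "p < 1"
    unfolding T_star_eq y(1) q(1) using that y pq by (simp add: divide_ennreal)
  have "p = 1 / 2 \<and> x = y" if "w = b"
  proof
    have "emeasure ?D ?B = emeasure ?D ?W" using emeasure_black_wins_swap[of w b] that by simp
    then show "p = 1 / 2" using p q pq by simp
    have "?Y = ?X" using swap that by simp
    then show "x = y" using x y by simp
  qed
  then show thesis using that p x y T T_star by blast
qed

section \<open>The diagonal identity and the limit\<close>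

lemma T_star_diagonal:
  assumes "0 < k" shows "T_star k k = T k k"
proof -
  obtain p x y :: real where "k = k \<Longrightarrow> p = 1 / 2 \<and> x = y"
    "T k k = ereal (x + y)" "p < 1 \<Longrightarrow> T_star k k = ereal (y / (1 - p))"
    using times_decomposition[of k k] assms by (metis add_gr_0)
  moreover from this have "p = 1 / 2" "x = y" by simp_all
  \<comment> \<open>With \<open>p = 1 / 2\<close> and \<open>x = y\<close>, both sides equal
    \<open>2 * y\<close>.\<close>
  ultimately show ?thesis by simp
qed

text \<open>The difference equals \<open>y * p / (1 - p) - x\<close>, where both terms are
  nonnegative and at most the stated bound; \<open>half\<close> gives
  \<open>1 / (1 - p) \<le> 2\<close>.\<close>

lemma T_star_minus_T_bound:
  assumes "0 < w + b" and half: "binom_cdf (w + b) w \<le> 1 / 2"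
  shows "\<bar>T_star w b - T w b\<bar> \<le> ereal (2 * (real (w + b) ^ 3 * binom_cdf (w + b) w))"
proof -
  let ?g = "binom_cdf (w + b) w" and ?M = "real (w + b) ^ 3"
  obtain p x y :: real where pxy: "0 \<le> p" "p \<le> ?g" "0 \<le> x" "x \<le> ?M * ?g" "0 \<le> y" "y \<le> ?M"
    "T w b = ereal (x + y)" "p < 1 \<Longrightarrow> T_star w b = ereal (y / (1 - p))"
    by (rule times_decomposition[OF assms(1)]) blast
  have p: "p \<le> 1 / 2" using pxy half by simp
  have "y / (1 - p) - (x + y) = y * p / (1 - p) - x" using p by (simp add: field_simps)
  moreover have "y * p / (1 - p) \<le> 2 * (?M * ?g)"
  proof -
    have "y * p / (1 - p) \<le> y * p / (1 / 2)"
      using p pxy by (intro divide_left_mono) auto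
    also have "\<dots> \<le> 2 * (?M * ?g)" using mult_mono[OF pxy(6,2)] pxy by simp
    finally show ?thesis .
  qed
  moreover have "0 \<le> y * p / (1 - p)" using p pxy by simp
  moreover have "0 \<le> ?M * ?g" by (simp add: binom_cdf_nonneg)
  ultimately have "\<bar>y / (1 - p) - (x + y)\<bar> \<le> 2 * (?M * ?g)" using pxy by linarith
  then show ?thesis using pxy p by simp
qed

text \<open>As \<open>N\<close> is an integer, the floor of \<open>N - z\<close> is \<open>N\<close>
  minus the ceiling of \<open>z\<close>; the bounds on \<open>x\<close> keep \<open>nat\<close> from
  truncating.\<close>

lemma floor_plus_ceiling_complement:
  fixes x :: real
  assumes "0 \<le> x" "x \<le> 1"
  shows "nat \<lfloor>(1 - x) * real N\<rfloor> + nat \<lceil>x * real N\<rceil> = N"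
proof -
  have "0 \<le> x * real N" using assms by simp
  have "\<lfloor>(1 - x) * real N\<rfloor> = int N - \<lceil>x * real N\<rceil>"
    by (simp add: algebra_simps ceiling_def) linarith
  moreover have "0 \<le> \<lfloor>(1 - x) * real N\<rfloor>" "0 \<le> \<lceil>x * real N\<rceil>"
    using assms less_le_trans[OF _ \<open>0 \<le> x * real N\<close>, of "-1"] by simp_all
  ultimately show ?thesis by linarith
qed

lemma T_star_minus_T_tendsto_0:
  fixes x :: real
  assumes "1 / 2 < x" "x < 1"
  shows "(\<lambda>N. T_star (nat \<lfloor>(1 - x) * real N\<rfloor>) (nat \<lceil>x * real N\<rceil>) -
    T (nat \<lfloor>(1 - x) * real N\<rfloor>) (nat \<lceil>x * real N\<rceil>)) \<longlonglongrightarrow> 0"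
proof -
  define e where "e N = real N ^ 3 * binom_cdf N (nat \<lfloor>(1 - x) * real N\<rfloor>)" for N
  define d where "d N = T_star (nat \<lfloor>(1 - x) * real N\<rfloor>) (nat \<lceil>x * real N\<rceil>) -
    T (nat \<lfloor>(1 - x) * real N\<rfloor>) (nat \<lceil>x * real N\<rceil>)" for N
  have e: "e \<longlonglongrightarrow> 0" unfolding e_def using assms by (intro binom_cdf_floor_tendsto_0) simp
  have "\<forall>\<^sub>F N in sequentially. e N < 1 / 2" using order_tendstoD(2)[OF e, of "1 / 2"] by simp
  then have bound: "\<forall>\<^sub>F N in sequentially. \<bar>d N\<bar> \<le> ereal (2 * e N)"
    using eventually_gt_at_top[of 0]
  proof eventually_elim
    case (elim N)
    let ?w = "nat \<lfloor>(1 - x) * real N\<rfloor>" and ?b = "nat \<lceil>x * real N\<rceil>"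
    have N: "?w + ?b = N" using assms by (intro floor_plus_ceiling_complement) auto
    \<comment> \<open>Since \<open>N \<ge> 1\<close>, the cubic factor is at least 1, so
      \<open>e N < 1 / 2\<close> also yields the hypothesis \<open>half\<close>.\<close>
    have "1 * binom_cdf N ?w \<le> e N"
      unfolding e_def using elim by (intro mult_right_mono binom_cdf_nonneg) simp
    then have "\<bar>T_star ?w ?b - T ?w ?b\<bar> \<le> ereal (2 * (real (?w + ?b) ^ 3 * binom_cdf (?w + ?b) ?w))"
      using elim by (intro T_star_minus_T_bound) (simp_all only: N)
    then show ?case by (simp only: N d_def e_def)
  qed
  have lim: "(\<lambda>N. ereal (2 * e N)) \<longlonglongrightarrow> 0" "(\<lambda>N. - ereal (2 * e N)) \<longlonglongrightarrow> 0"
    using tendsto_mult_left[OF e, of 2] tendsto_minus[OF tendsto_mult_left[OF e, of 2]]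
    by (simp_all add: zero_ereal_def)
  have "d \<longlonglongrightarrow> 0"
  proof (rule tendsto_sandwich[OF _ _ lim(2,1)])
    have abs_leD: "- ereal c \<le> z \<and> z \<le> ereal c" if "\<bar>z\<bar> \<le> ereal c" for z c
      using that by (cases z) auto
    show "\<forall>\<^sub>F N in sequentially. - ereal (2 * e N) \<le> d N"
      using bound by eventually_elim (simp only: abs_leD)
    show "\<forall>\<^sub>F N in sequentially. d N \<le> ereal (2 * e N)"
      using bound by eventually_elim (simp only: abs_leD)
  qed
  then show ?thesis unfolding d_def .
qed

theorem proposition2p6:
  "(\<forall>k::nat. k > 0 \<longrightarrow> T_star k k = T k k) \<and>
   (\<forall>x::real. 1/2 < x \<and> x < 1 \<longrightarrow>
      (\<lambda>N::nat.
         T_star (nat \<lfloor>(1 - x) * real N\<rfloor>) (nat \<lceil>x * real N\<rceil>) -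
         T (nat \<lfloor>(1 - x) * real N\<rfloor>) (nat \<lceil>x * real N\<rceil>)) \<longlonglongrightarrow> 0)"
  using T_star_diagonal T_star_minus_T_tendsto_0 by blast

end
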